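(* Consider a deterministic walk in a deterministic environment (DWDE) on $\mathbb{Z}$ as in the context. Suppose that the DWDE has an ergodic, stationary environment, and is driven by a full-branch Gibbs-Markov transformation $T$ of a probability space $(X,m)$, with finite Markov partition $\beta$ and Gibbs potential $h$. Suppose further that for some $1\le r\le\#\beta-1$, and all transition functions $f\in G$, $$\#\{a\in\beta:f(a)=+1\}=r\quad\text{and}\quad\#\{a\in\beta:f(a)=-1\}=\#\beta-r.$$ Then: (i) If $\inf h>\frac12\ln\big(4r(\#\beta-r)\big)$ and $r>\frac{\#\beta}{2}$, then $\lim_{n\to\infty}U_{i,n}(x,\omega)=+\infty$ for all $i\in\mathbb{Z}$, $P$-a.e. $\omega$ and $m$-a.e. $x$. (ii) If $\inf h>\frac12\ln\big(4r(\#\beta-r)\big)$ and $r<\frac{\#\beta}{2}$, then $\lim_{n\to\infty}U_{i,n}(x,\omega)=-\infty$ for all $i\in\mathbb{Z}$, $P$-a.e. $\omega$ and $m$-a.e. $x$.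
   Context: Base map. A non-singular transformation $T$ of a measure space $(X,m)$ is Markov with measurable Markov partition $\beta$ of $X$ if for every $a\in\beta$, $T(a)$ is a union of elements of $\beta$ and $T|_a:a\to T(a)$ is a bijection. $n$-cylinders are the sets $[a_0,\dots,a_{n-1}]:=\bigcap_{j=0}^{n-1}T^{-j}a_j$ with $a_j\in\beta$; $\beta_n$ is the collection of all $n$-cylinders. $\beta$ is assumed to separate points (for all $x\ne y$ in $X$ there are $n\ge1$ and $a,b\in\beta_n$ with $a\cap b=\emptyset$, $x\in a$, $y\in b$). $T$ is full-branch if $Ta=X$ for all $a\in\beta$. Gibbs-Markov. Let $g:=\frac{dm}{d(m\circ T)}$ (derivative taken on each $a\in\beta$, where $T$ is injective). A Markov map $T$ of a probability space $(X,m)$ is Gibbs-Markov (standard notion) if $\inf_{a\in\beta}m(Ta)>0$ and there are constants $K>0$, $\theta\in(0,1)$ with $|\ln g(x)-\ln g(y)|\le K\theta^{s(Tx,Ty)}$ for all $a\in\beta$ and $x,y\in a$, where $s(x,y)$ is the largest $n\ge0$ such that $x,y$ lie in the same $n$-cylinder (with $s(x,x)=\infty$). Such maps have the property that there is $C\ge1$ with $C^{-1}g(x)g(Tx)\cdots g(T^{n-1}x)\le m(a)\le Cg(x)g(Tx)\cdots g(T^{n-1}x)$ for all $n\ge1$, $a\in\beta_n$, $x\in a$. The Gibbs potential of $m$ is $h:=-\ln g$. Environment. $G$ is a set of functions $X\to\mathbb{Z}$ constant on elements of $\beta$ (for $f\in G$ and $a\in\beta$, $f(a)$ is the constant value of $f$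 on $a$); as $\beta$ is finite, $G$ is countable and carries the discrete $\sigma$-algebra. $\eta:\Omega\to\Omega$ is an invertible measurable transformation of a probability space $(\Omega,P)$ and $\phi:\Omega\to G$ is measurable. Each $\omega$ encodes the environment $(f_i)_{i\in\mathbb{Z}}$, $f_i:=\phi(\eta^i\omega)$. The environment is ergodic and stationary if $\eta$ preserves $P$ and is ergodic. DWDE. The skew-product is $T_{f(\omega)}(x,i)=(Tx,i+f_i(x))$ on $X\times\mathbb{Z}$; the DWDE is $U_{i,n}(x,\omega):=\pi_2(T^n_{f(\omega)}(x,i))$, where $\pi_2(x,y)=y$. *)

theory Defs
  imports "HOL-Probability.Probability"
begin

section \<open>Markov maps\<close>

definition nonsingular :: "'a measure \<Rightarrow> ('a \<Rightarrow> 'a) \<Rightarrow> bool" where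
  "nonsingular M T \<longleftrightarrow> T \<in> measurable M M \<and>
     (\<forall>A\<in>sets M. emeasure M (T -` A \<inter> space M) = 0 \<longleftrightarrow> emeasure M A = 0)"

definition cylinder :: "'a measure \<Rightarrow> ('a \<Rightarrow> 'a) \<Rightarrow> 'a set list \<Rightarrow> 'a set" where
  "cylinder M T as = {x \<in> space M. \<forall>j<length as. (T ^^ j) x \<in> as ! j}"

text \<open>The only 0-cylinder is the whole space.\<close>

definition cylinders :: "'a measure \<Rightarrow> ('a \<Rightarrow> 'a) \<Rightarrow> 'a set set \<Rightarrow> nat \<Rightarrow> 'a set set" where
  "cylinders M T \<beta> n = {cylinder M T as |as. length as = n \<and> set as \<subseteq> \<beta>}"

definition separates_points :: "'a measure \<Rightarrow> ('a \<Rightarrow> 'a) \<Rightarrow> 'a set set \<Rightarrow> bool" where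
  "separates_points M T \<beta> \<longleftrightarrow>
     (\<forall>x\<in>space M. \<forall>y\<in>space M. x \<noteq> y \<longrightarrow>
        (\<exists>n\<ge>1. \<exists>a\<in>cylinders M T \<beta> n. \<exists>b\<in>cylinders M T \<beta> n.
           a \<inter> b = {} \<and> x \<in> a \<and> y \<in> b))"

text \<open>
  As usual for Markov maps, the inverse of the bijection from a partition element onto its image is
  also measurable, that is, \<open>T\<close> maps measurable subsets of a partition element to measurable sets.
  Without this the set function \<open>A \<mapsto> m (T A)\<close>, hence the derivative of \<open>m\<close> with respect to it,
  would not be defined.
\<close>

definition markov_map :: "'a measure \<Rightarrow> ('a \<Rightarrow> 'a) \<Rightarrow> 'a set set \<Rightarrow> bool" where
  "markov_map M T \<beta> \<longleftrightarrow>
     nonsingular M T \<and>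
     partition_on (space M) \<beta> \<and> \<beta> \<subseteq> sets M \<and>
     (\<forall>a\<in>\<beta>. (\<exists>B\<subseteq>\<beta>. T ` a = \<Union>B) \<and> bij_betw T a (T ` a) \<and>
        (\<forall>A\<in>sets M. A \<subseteq> a \<longrightarrow> T ` A \<in> sets M)) \<and>
     separates_points M T \<beta>"

definition full_branch :: "'a measure \<Rightarrow> ('a \<Rightarrow> 'a) \<Rightarrow> 'a set set \<Rightarrow> bool" where
  "full_branch M T \<beta> \<longleftrightarrow> (\<forall>a\<in>\<beta>. T ` a = space M)"

section \<open>Gibbs-Markov maps\<close>

text \<open>The measure \<open>m \<circ> T\<close> on a partition element \<open>a\<close>.\<close>

definition image_measure_on :: "'a measure \<Rightarrow> ('a \<Rightarrow> 'a) \<Rightarrow> 'a set \<Rightarrow> 'a measure" where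
  "image_measure_on M T a =
     measure_of a (sets (restrict_space M a)) (\<lambda>A. emeasure M (T ` A))"

lemma sets_image_measure_on:
  assumes "a \<in> sets M"
  shows "sets (image_measure_on M T a) = sets (restrict_space M a)"
proof -
  have "space (restrict_space M a) = a"
    using assms sets.sets_into_space by (auto simp: space_restrict_space)
  then have "sigma_algebra a (sets (restrict_space M a))"
    by (metis sets.sigma_algebra_axioms)
  then show ?thesis
    unfolding image_measure_on_def by (rule sigma_algebra.sets_measure_of_eq)
qed

lemma emeasure_image_measure_on:
  assumes T: "markov_map M T \<beta>" and a: "a \<in> \<beta>" and A: "A \<in> sets M" "A \<subseteq> a"
  shows "emeasure (image_measure_on M T a) A = emeasure M (T ` A)"
proof -
  have aM: "a \<in> sets M" and inj: "inj_on T a"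
    and im: "\<And>B. B \<in> sets M \<Longrightarrow> B \<subseteq> a \<Longrightarrow> T ` B \<in> sets M"
    using T a by (auto simp: markov_map_def bij_betw_def)
  have sp: "space (restrict_space M a) = a"
    using aM sets.sets_into_space by (auto simp: space_restrict_space)
  have R: "\<And>B. B \<in> sets (restrict_space M a) \<longleftrightarrow> B \<in> sets M \<and> B \<subseteq> a"
    using aM by (subst sets_restrict_space_iff) (auto intro: sets.Int_space_eq2)
  show ?thesis
  proof (rule emeasure_measure_of[OF image_measure_on_def])
    show "sets (restrict_space M a) \<subseteq> Pow a" using R by auto
    show "A \<in> sets (image_measure_on M T a)"
      using A R aM by (simp add: sets_image_measure_on)
    show "positive (sets (image_measure_on M T a)) (\<lambda>A. emeasure M (T ` A))"
      by (simp add: positive_def)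
    show "countably_additive (sets (image_measure_on M T a)) (\<lambda>A. emeasure M (T ` A))"
    proof (rule countably_additiveI)
      fix S :: "nat \<Rightarrow> 'a set"
      assume S: "range S \<subseteq> sets (image_measure_on M T a)" "disjoint_family S"
      then have S': "\<And>i. S i \<in> sets M \<and> S i \<subseteq> a"
        using R aM by (auto simp: sets_image_measure_on)
      have "disjoint_family (\<lambda>i. T ` S i)"
        using S(2) S' inj unfolding disjoint_family_on_def
        by (metis inj_on_image_Int image_empty)
      then have "(\<Sum>i. emeasure M (T ` S i)) = emeasure M (\<Union>i. T ` S i)"
        using S' im by (intro suminf_emeasure) auto
      then show "(\<Sum>i. emeasure M (T ` S i)) = emeasure M (T ` \<Union>(range S))"
        by (simp add: image_UN)
    qed
  qed
qed

text \<open>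
  \<open>g\<close> is a version of the derivative of \<open>m\<close> with respect to \<open>m \<circ> T\<close>.  The function is fixed and not
  only determined up to null sets, since the distortion condition and the infimum of the potential
  are pointwise; it is positive, so that its logarithm is defined everywhere.
\<close>

definition is_derivative_of_measure ::
    "'a measure \<Rightarrow> ('a \<Rightarrow> 'a) \<Rightarrow> 'a set set \<Rightarrow> ('a \<Rightarrow> real) \<Rightarrow> bool" where
  "is_derivative_of_measure M T \<beta> g \<longleftrightarrow>
     g \<in> borel_measurable M \<and> (\<forall>x\<in>space M. g x > 0) \<and>
     (\<forall>a\<in>\<beta>. density (image_measure_on M T a) (\<lambda>x. ennreal (g x)) = restrict_space M a)"

definition separation_time ::
    "'a measure \<Rightarrow> ('a \<Rightarrow> 'a) \<Rightarrow> 'a set set \<Rightarrow> 'a \<Rightarrow> 'a \<Rightarrow> enat" where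
  "separation_time M T \<beta> x y =
     Sup {enat n |n. \<exists>c\<in>cylinders M T \<beta> n. x \<in> c \<and> y \<in> c}"

definition power_enat :: "real \<Rightarrow> enat \<Rightarrow> real" where
  "power_enat \<theta> s = (case s of enat n \<Rightarrow> \<theta> ^ n | \<infinity> \<Rightarrow> 0)"

definition gibbs_markov ::
    "'a measure \<Rightarrow> ('a \<Rightarrow> 'a) \<Rightarrow> 'a set set \<Rightarrow> ('a \<Rightarrow> real) \<Rightarrow> bool" where
  "gibbs_markov M T \<beta> g \<longleftrightarrow>
     prob_space M \<and> markov_map M T \<beta> \<and> is_derivative_of_measure M T \<beta> g \<and>
     (INF a\<in>\<beta>. measure M (T ` a)) > 0 \<and>
     (\<exists>K>0. \<exists>\<theta>\<in>{0<..<1}. \<forall>a\<in>\<beta>. \<forall>x\<in>a. \<forall>y\<in>a.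
        \<bar>ln (g x) - ln (g y)\<bar> \<le> K * power_enat \<theta> (separation_time M T \<beta> (T x) (T y)))"

definition gibbs_potential :: "('a \<Rightarrow> real) \<Rightarrow> 'a \<Rightarrow> real" where
  "gibbs_potential g x = - ln (g x)"

section \<open>Environments\<close>

text \<open>
  Functions on the space of \<open>M\<close> are represented by extensional functions, so that two transition
  functions that agree on the space are equal.
\<close>

definition transition_functions :: "'a measure \<Rightarrow> 'a set set \<Rightarrow> ('a \<Rightarrow> int) set \<Rightarrow> bool" where
  "transition_functions M \<beta> G \<longleftrightarrow>
     G \<subseteq> extensional (space M) \<and> (\<forall>f\<in>G. \<forall>a\<in>\<beta>. \<exists>c. \<forall>x\<in>a. f x = c)"

definition value_on :: "('a \<Rightarrow> int) \<Rightarrow> 'a set \<Rightarrow> int" where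
  "value_on f a = the_elem (f ` a)"

definition invertible_measurable :: "'w measure \<Rightarrow> ('w \<Rightarrow> 'w) \<Rightarrow> bool" where
  "invertible_measurable P \<eta> \<longleftrightarrow>
     bij_betw \<eta> (space P) (space P) \<and> \<eta> \<in> measurable P P \<and>
     the_inv_into (space P) \<eta> \<in> measurable P P"

definition int_iterate :: "'w measure \<Rightarrow> ('w \<Rightarrow> 'w) \<Rightarrow> int \<Rightarrow> 'w \<Rightarrow> 'w" where
  "int_iterate P \<eta> i =
     (if i \<ge> 0 then \<eta> ^^ nat i else the_inv_into (space P) \<eta> ^^ nat (- i))"

definition environment ::
    "'w measure \<Rightarrow> ('w \<Rightarrow> 'w) \<Rightarrow> ('w \<Rightarrow> 'a \<Rightarrow> int) \<Rightarrow> 'w \<Rightarrow> int \<Rightarrow> 'a \<Rightarrow> int" where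
  "environment P \<eta> \<phi> \<omega> i = \<phi> (int_iterate P \<eta> i \<omega>)"

definition ergodic_stationary :: "'w measure \<Rightarrow> ('w \<Rightarrow> 'w) \<Rightarrow> bool" where
  "ergodic_stationary P \<eta> \<longleftrightarrow>
     distr P P \<eta> = P \<and>
     (\<forall>A\<in>sets P. \<eta> -` A \<inter> space P = A \<longrightarrow> measure P A = 0 \<or> measure P A = 1)"

section \<open>Deterministic walks in deterministic environments\<close>

definition skew_product ::
    "('a \<Rightarrow> 'a) \<Rightarrow> (int \<Rightarrow> 'a \<Rightarrow> int) \<Rightarrow> 'a \<times> int \<Rightarrow> 'a \<times> int" where
  "skew_product T f = (\<lambda>(x, i). (T x, i + f i x))"

definition dwde ::
    "('a \<Rightarrow> 'a) \<Rightarrow> 'w measure \<Rightarrow> ('w \<Rightarrow> 'w) \<Rightarrow> ('w \<Rightarrow> 'a \<Rightarrow> int) \<Rightarrow>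
     int \<Rightarrow> nat \<Rightarrow> 'a \<Rightarrow> 'w \<Rightarrow> int" where
  "dwde T P \<eta> \<phi> i n x \<omega> = snd ((skew_product T (environment P \<eta> \<phi> \<omega>) ^^ n) (x, i))"

end

theory Submission
  imports Defs
begin

text \<open>
  Let \<open>k = #\<beta>\<close> and \<open>t = sqrt ((k - r) / r)\<close>.  If \<open>g \<le> \<kappa>\<close>, then on every full branch \<open>a\<close> the integral of
  \<open>F \<circ> T\<close> over \<open>a\<close> is at most \<open>\<kappa>\<close> times the integral of \<open>F\<close>.  Conditioning on the first step of the
  walk, the \<open>m\<close>-integral of \<open>t\<close> to the power \<open>U\<^bsub>i,n\<^esub>\<close> is therefore at most \<open>t\<close> to the power \<open>i\<close> times
  \<open>\<rho>\<^sup>n\<close>, where \<open>\<rho> = \<kappa> (r t + (k - r) / t) = 2 \<kappa> sqrt (r (k - r))\<close>.  The bound on the potential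
  says that \<open>\<rho> < 1\<close>, so these integrals are summable in \<open>n\<close> and \<open>t\<close> to the power \<open>U\<^bsub>i,n\<^esub>\<close> tends to
  \<open>0\<close> almost everywhere, for every single environment.  Finally \<open>t < 1\<close> in case (i) and \<open>t > 1\<close> in
  case (ii).
\<close>

section \<open>Change of variables on a full branch\<close>

text \<open>Since \<open>a\<close> covers the whole space under \<open>T\<close>, the points of
  \<open>a\<close> that \<open>T\<close> sends into \<open>A\<close> have image exactly
  \<open>A\<close>, so their mass under the measure m o T is that of \<open>A\<close> under
  \<open>M\<close>.\<close>

lemma distr_image_measure_on_full_branch:
  assumes "markov_map M T \<beta>" and "full_branch M T \<beta>" and "a \<in> \<beta>"
  shows "distr (image_measure_on M T a) M T = M"
proof (rule measure_eqI)
  let ?I = "image_measure_on M T a"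
  have aM: "a \<in> sets M" and TM: "T \<in> measurable M M" and Ta: "T ` a = space M"
    using assms by (auto simp: markov_map_def nonsingular_def full_branch_def)
  have T_meas: "T \<in> measurable ?I M"
    using measurable_restrict_space1[OF TM] aM
    by (simp add: measurable_cong_sets[OF sets_image_measure_on[OF aM] refl])
  have spI: "space ?I = a"
    using sets_eq_imp_space_eq[OF sets_image_measure_on[OF aM]] sets.sets_into_space[OF aM]
    by (auto simp: space_restrict_space)
  fix A assume "A \<in> sets (distr ?I M T)"
  then have A: "A \<in> sets M" by simp
  have vim: "T -` A \<inter> a \<in> sets M"
    using measurable_sets[OF TM A] aM sets.sets_into_space[OF aM]
    by (metis Int_absorb1 inf_assoc sets.Int)
  have "emeasure (distr ?I M T) A = emeasure ?I (T -` A \<inter> a)"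
    using A T_meas spI by (simp add: emeasure_distr)
  also have "\<dots> = emeasure M (T ` (T -` A \<inter> a))"
    using emeasure_image_measure_on[OF assms(1,3) vim] by simp
  also have "T ` (T -` A \<inter> a) = A \<inter> T ` a" by auto
  also have "\<dots> = A"
    unfolding Ta using sets.sets_into_space[OF A] by (rule Int_absorb2)
  finally show "emeasure (distr ?I M T) A = emeasure M A" .
qed simp

text \<open>On \<open>a\<close> the measure \<open>M\<close> has density \<open>g\<close> with
  respect to m o T. Bounding \<open>g\<close> by \<kappa> leaves an integral of \<open>F\<close> o
  \<open>T\<close> against m o T, and \<open>T\<close> pushes m o T forward to
  \<open>M\<close>.\<close>

lemma nn_integral_branch_le:
  fixes F :: "'a \<Rightarrow> ennreal"
  assumes "markov_map M T \<beta>" and "full_branch M T \<beta>" and "is_derivative_of_measure M T \<beta> g"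
    and "a \<in> \<beta>" and "\<forall>x\<in>space M. g x \<le> \<kappa>" and F: "F \<in> borel_measurable M"
  shows "(\<integral>\<^sup>+x. F (T x) * indicator a x \<partial>M) \<le> ennreal \<kappa> * (\<integral>\<^sup>+x. F x \<partial>M)"
proof -
  let ?I = "image_measure_on M T a"
  have aM: "a \<in> sets M" and TM: "T \<in> measurable M M"
    using assms(1,4) by (auto simp: markov_map_def nonsingular_def)
  have g: "g \<in> borel_measurable M" and dens: "density ?I (\<lambda>x. ennreal (g x)) = restrict_space M a"
    using assms(3,4) by (auto simp: is_derivative_of_measure_def)
  note sI = sets_image_measure_on[OF aM]
  have spI: "space ?I = a"
    using sets_eq_imp_space_eq[OF sI] sets.sets_into_space[OF aM]
    by (auto simp: space_restrict_space)
  have g_meas: "g \<in> borel_measurable ?I" and T_meas: "T \<in> measurable ?I M"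
    using measurable_restrict_space1[OF g] measurable_restrict_space1[OF TM]
    by (simp_all add: measurable_cong_sets[OF sI refl])
  have FT_meas: "(\<lambda>x. F (T x)) \<in> borel_measurable ?I"
    using measurable_compose[OF T_meas F] .
  have "(\<integral>\<^sup>+x. F (T x) * indicator a x \<partial>M) = (\<integral>\<^sup>+x. F (T x) \<partial>restrict_space M a)"
    using aM by (simp add: nn_integral_restrict_space)
  also have "\<dots> = (\<integral>\<^sup>+x. ennreal (g x) * F (T x) \<partial>?I)"
    unfolding dens[symmetric] using g_meas FT_meas by (simp add: nn_integral_density)
  also have "\<dots> \<le> (\<integral>\<^sup>+x. ennreal \<kappa> * F (T x) \<partial>?I)"
    using assms(5) sets.sets_into_space[OF aM] spI
    by (intro nn_integral_mono mult_right_mono ennreal_leI) auto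
  also have "\<dots> = ennreal \<kappa> * (\<integral>\<^sup>+x. F (T x) \<partial>?I)"
    using FT_meas by (rule nn_integral_cmult)
  also have "(\<integral>\<^sup>+x. F (T x) \<partial>?I) = (\<integral>\<^sup>+x. F x \<partial>M)"
    using nn_integral_distr[OF T_meas, of F] F
    by (simp add: distr_image_measure_on_full_branch[OF assms(1,2,4)])
  finally show ?thesis .
qed

section \<open>Measurability and exponential moments of the walk in a fixed environment\<close>

lemma measurable_count_space_piecewise_constant:
  fixes f :: "'a \<Rightarrow> 'b"
  assumes "partition_on (space M) \<beta>" and "\<beta> \<subseteq> sets M" and "finite \<beta>"
    and const: "\<And>a x. a \<in> \<beta> \<Longrightarrow> x \<in> a \<Longrightarrow> f x = v a"
  shows "f \<in> measurable M (count_space UNIV)"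
proof (rule measurableI)
  fix A
  have un: "\<Union>\<beta> = space M"
    using assms(1) by (simp add: partition_on_def)
  have "f -` A \<inter> space M = \<Union>{a \<in> \<beta>. v a \<in> A}"
    unfolding un[symmetric] using const by fastforce
  also have "\<dots> \<in> sets M"
    using assms(2,3) by (intro sets.finite_Union) auto
  finally show "f -` A \<inter> space M \<in> sets M" .
qed simp

definition walk :: "('a \<Rightarrow> 'a) \<Rightarrow> (int \<Rightarrow> 'a \<Rightarrow> int) \<Rightarrow> nat \<Rightarrow> int \<Rightarrow> 'a \<Rightarrow> int" where
  "walk T f n i x = snd ((skew_product T f ^^ n) (x, i))"

lemma walk_0 [simp]: "walk T f 0 i x = i"
  by (simp add: walk_def)

text \<open>The first step is split off, not the last: on a partition element the remaining walk
  then starts at a constant site and depends on \<open>x\<close> only through \<open>T x\<close>,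
  the form required by the branch estimate.\<close>

lemma walk_Suc: "walk T f (Suc n) i x = walk T f n (i + f i x) (T x)"
  unfolding walk_def funpow_Suc_right by (simp add: skew_product_def)

lemma dwde_eq_walk: "dwde T P \<eta> \<phi> i n x \<omega> = walk T (environment P \<eta> \<phi> \<omega>) n i x"
  by (simp add: dwde_def walk_def)

lemma measurable_walk:
  assumes T: "T \<in> measurable M M"
    and f: "\<And>i. f i \<in> measurable M (count_space UNIV)"
  shows "walk T f n i \<in> measurable M (count_space UNIV)"
proof (induction n arbitrary: i)
  case 0
  then show ?case by (simp add: walk_def)
next
  case (Suc n)
  \<comment> \<open>The new starting site depends on \<open>x\<close>, but takes only countably many
    values, so it may be frozen at a constant \<open>j\<close>.\<close>
  have "(\<lambda>x. walk T f n (i + f i x) (T x)) \<in> measurable M (count_space UNIV)"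
  proof (rule measurable_compose_countable[OF _ f])
    fix j
    show "(\<lambda>x. walk T f n (i + j) (T x)) \<in> measurable M (count_space UNIV)"
      using measurable_compose[OF T Suc.IH] .
  qed
  then show ?case by (simp add: walk_Suc[abs_def])
qed

text \<open>Induction on \<open>n\<close> with the starting site free: each step costs at most a
  factor \<rho>, because the one-step bound \<open>sum_le\<close> is uniform over all sites.\<close>

lemma nn_integral_powr_walk_le:
  assumes M: "markov_map M T \<beta>" "full_branch M T \<beta>" "is_derivative_of_measure M T \<beta> g"
    and fin: "finite \<beta>" and "prob_space M" and g: "\<forall>x\<in>space M. g x \<le> \<kappa>" and "0 \<le> \<kappa>"
    and const: "\<And>i a x. a \<in> \<beta> \<Longrightarrow> x \<in> a \<Longrightarrow> f i x = v i a"
    and t: "0 < t" and sum_le: "\<And>i. \<kappa> * (\<Sum>a\<in>\<beta>. t powr real_of_int (v i a)) \<le> \<rho>"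
  shows "(\<integral>\<^sup>+x. ennreal (t powr real_of_int (walk T f n i x)) \<partial>M)
           \<le> ennreal (t powr real_of_int i * \<rho> ^ n)"
proof (induction n arbitrary: i)
  case 0
  interpret prob_space M by fact
  show ?case by (simp add: emeasure_space_1)
next
  case (Suc n)
  have part: "partition_on (space M) \<beta>" and sub: "\<beta> \<subseteq> sets M" and TM: "T \<in> measurable M M"
    using M(1) by (auto simp: markov_map_def nonsingular_def)
  have un: "\<Union>\<beta> = space M" and disj: "disjoint \<beta>"
    using part by (auto simp: partition_on_def)
  have "f j \<in> measurable M (count_space UNIV)" for j
    using measurable_count_space_piecewise_constant[OF part sub fin, of "f j" "v j"] const by blast
  then have W: "walk T f n j \<in> measurable M (count_space UNIV)" for n j
    by (rule measurable_walk[OF TM])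
  let ?F = "\<lambda>n j x. ennreal (t powr real_of_int (walk T f n j x))"
  have F: "?F n j \<in> borel_measurable M" for n j
    by (rule measurable_compose[OF W]) simp
  have "0 \<le> \<kappa> * (\<Sum>a\<in>\<beta>. t powr real_of_int (v i a))"
    using \<open>0 \<le> \<kappa>\<close> by (intro mult_nonneg_nonneg sum_nonneg) auto
  with sum_le[of i] have \<rho>: "0 \<le> \<rho>" by linarith
  have "(\<integral>\<^sup>+x. ?F (Suc n) i x \<partial>M)
      = (\<integral>\<^sup>+x. (\<Sum>a\<in>\<beta>. ?F n (i + v i a) (T x) * indicator a x) \<partial>M)"
  proof (rule nn_integral_cong)
    fix x assume "x \<in> space M"
    then obtain b where b: "b \<in> \<beta>" "x \<in> b" using un by blast
    \<comment> \<open>The partition elements are disjoint, so only the branch containing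
      \<open>x\<close> contributes to the sum.\<close>
    have "indicator a x = (if a = b then 1 else 0 :: ennreal)" if "a \<in> \<beta>" for a
      using that b disj by (auto simp: disjoint_def indicator_def)
    then have "(\<Sum>a\<in>\<beta>. ?F n (i + v i a) (T x) * indicator a x)
        = (\<Sum>a\<in>\<beta>. if a = b then ?F n (i + v i b) (T x) else 0)"
      by (intro sum.cong) auto
    also have "\<dots> = ?F n (i + v i b) (T x)"
      using fin b by simp
    finally show "?F (Suc n) i x = (\<Sum>a\<in>\<beta>. ?F n (i + v i a) (T x) * indicator a x)"
      using const[OF b] by (simp add: walk_Suc)
  qed
  also have "\<dots> = (\<Sum>a\<in>\<beta>. \<integral>\<^sup>+x. ?F n (i + v i a) (T x) * indicator a x \<partial>M)"
  proof (rule nn_integral_sum)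
    fix a assume "a \<in> \<beta>"
    then show "(\<lambda>x. ?F n (i + v i a) (T x) * indicator a x) \<in> borel_measurable M"
      using sub measurable_compose[OF TM F] by (intro borel_measurable_times_ennreal) auto
  qed
  also have "\<dots> \<le> (\<Sum>a\<in>\<beta>. ennreal \<kappa> * (\<integral>\<^sup>+x. ?F n (i + v i a) x \<partial>M))"
    using nn_integral_branch_le[OF M _ g F] by (intro sum_mono)
  also have "\<dots> \<le> (\<Sum>a\<in>\<beta>. ennreal \<kappa> * ennreal (t powr real_of_int (i + v i a) * \<rho> ^ n))"
    by (intro sum_mono mult_left_mono Suc.IH) simp
  also have "\<dots> = (\<Sum>a\<in>\<beta>. ennreal (\<kappa> * (t powr real_of_int (i + v i a) * \<rho> ^ n)))"
    using \<open>0 \<le> \<kappa>\<close> \<rho> by (simp add: ennreal_mult)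
  also have "\<dots> = ennreal (\<Sum>a\<in>\<beta>. \<kappa> * (t powr real_of_int (i + v i a) * \<rho> ^ n))"
    using \<open>0 \<le> \<kappa>\<close> \<rho> by (intro sum_ennreal) simp
  \<comment> \<open>The weight is multiplicative in the displacement, so the starting site factors
    out and the one-step sum at \<open>i\<close> remains.\<close>
  also have "(\<Sum>a\<in>\<beta>. \<kappa> * (t powr real_of_int (i + v i a) * \<rho> ^ n))
      = t powr real_of_int i * \<rho> ^ n * (\<kappa> * (\<Sum>a\<in>\<beta>. t powr real_of_int (v i a)))"
    by (simp add: sum_distrib_left powr_add mult_ac)
  also have "ennreal \<dots> \<le> ennreal (t powr real_of_int i * \<rho> ^ n * \<rho>)"
    using \<rho> sum_le[of i] by (intro ennreal_leI mult_left_mono) auto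
  finally show ?case by (simp add: mult_ac)
qed

section \<open>From summable moments to divergence of the walk\<close>

text \<open>A first-moment Borel-Cantelli argument: the sum of all \<open>X n\<close> has finite
  integral, hence is finite almost everywhere, and the terms of a convergent series tend to
  0.\<close>

lemma AE_tendsto_0_of_nn_integral_geometric:
  fixes X :: "nat \<Rightarrow> 'a \<Rightarrow> real"
  assumes meas: "\<And>n. X n \<in> borel_measurable M" and nonneg: "\<And>n x. 0 \<le> X n x"
    and le: "\<And>n. (\<integral>\<^sup>+x. ennreal (X n x) \<partial>M) \<le> ennreal (c * \<rho> ^ n)"
    and "0 \<le> c" "0 \<le> \<rho>" "\<rho> < 1"
  shows "AE x in M. (\<lambda>n. X n x) \<longlonglongrightarrow> 0"
proof -
  have "(\<integral>\<^sup>+x. (\<Sum>n. ennreal (X n x)) \<partial>M) = (\<Sum>n. \<integral>\<^sup>+x. ennreal (X n x) \<partial>M)"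
    using meas by (intro nn_integral_suminf) auto
  also have "\<dots> \<le> (\<Sum>n. ennreal (c * \<rho> ^ n))"
    using le by (intro suminf_le) auto
  also have "\<dots> = ennreal (\<Sum>n. c * \<rho> ^ n)"
    using assms(4-6) by (intro suminf_ennreal2 summable_mult summable_geometric) auto
  also have "\<dots> < \<infinity>" by simp
  finally have "(\<integral>\<^sup>+x. (\<Sum>n. ennreal (X n x)) \<partial>M) \<noteq> \<infinity>" by simp
  then have "AE x in M. (\<Sum>n. ennreal (X n x)) \<noteq> \<infinity>"
    using meas by (intro nn_integral_PInf_AE) auto
  then show ?thesis
  proof (rule AE_mp, intro AE_I2 impI)
    fix x assume "(\<Sum>n. ennreal (X n x)) \<noteq> \<infinity>"
    then show "(\<lambda>n. X n x) \<longlonglongrightarrow> 0"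
      using nonneg by (intro summable_LIMSEQ_zero summable_suminf_not_top) auto
  qed
qed

text \<open>For \<open>t\<close> below 1 the power is decreasing in the exponent, so falling below
  \<open>t powr Z\<close> forces the exponent above \<open>Z\<close>.\<close>

lemma filterlim_at_top_of_powr_tendsto_0:
  fixes u :: "nat \<Rightarrow> int"
  assumes "(\<lambda>n. t powr real_of_int (u n)) \<longlonglongrightarrow> 0" and "0 < t" "t < 1"
  shows "filterlim u at_top sequentially"
  unfolding filterlim_at_top
proof
  fix Z :: int
  have "\<forall>\<^sub>F n in sequentially. t powr real_of_int (u n) < t powr real_of_int Z"
    using order_tendstoD(2)[OF assms(1)] assms(2) by simp
  then show "\<forall>\<^sub>F n in sequentially. Z \<le> u n"
  proof eventually_elim
    case (elim n)
    then show ?case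
      using powr_mono'[of "real_of_int (u n)" "real_of_int Z" t] assms(2,3) by force
  qed
qed

lemma filterlim_at_bot_of_powr_tendsto_0:
  fixes u :: "nat \<Rightarrow> int"
  assumes "(\<lambda>n. t powr real_of_int (u n)) \<longlonglongrightarrow> 0" and "1 < t"
  shows "filterlim u at_bot sequentially"
  unfolding filterlim_at_bot
proof
  fix Z :: int
  have "\<forall>\<^sub>F n in sequentially. t powr real_of_int (u n) < t powr real_of_int Z"
    by (rule order_tendstoD(2)[OF assms(1)]) (use assms(2) in simp)
  then show "\<forall>\<^sub>F n in sequentially. u n \<le> Z"
  proof eventually_elim
    case (elim n)
    then show ?case using assms(2) by simp
  qed
qed

section \<open>One-step moments and the choice of the constants\<close>

lemma sum_powr_plus_minus_one:
  fixes v :: "'b \<Rightarrow> int"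
  assumes "finite B" and "card {a \<in> B. v a = 1} = r" and "card {a \<in> B. v a = - 1} = card B - r"
    and "r \<le> card B" and "0 < t"
  shows "(\<Sum>a\<in>B. t powr real_of_int (v a)) = real r * t + (real (card B) - real r) / t"
proof -
  let ?U = "{a \<in> B. v a = 1}" and ?D = "{a \<in> B. v a = - 1}"
  have disj: "?U \<inter> ?D = {}" by auto
  \<comment> \<open>The two counts add up to \<open>card B\<close>, so \<open>v\<close> takes no
    values other than 1 and -1 on \<open>B\<close>.\<close>
  have "card (?U \<union> ?D) = card B"
    using assms disj by (subst card_Un_disjoint) auto
  then have B: "?U \<union> ?D = B"
    using assms(1) by (intro card_subset_eq) auto
  have "(\<Sum>a\<in>?U \<union> ?D. t powr real_of_int (v a))
      = (\<Sum>a\<in>?U. t powr real_of_int (v a)) + (\<Sum>a\<in>?D. t powr real_of_int (v a))"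
    using assms(1) disj by (intro sum.union_disjoint) auto
  also have "\<dots> = (\<Sum>a\<in>?U. t) + (\<Sum>a\<in>?D. 1 / t)"
    using assms(5) by (intro arg_cong2[of _ _ _ _ "(+)"] sum.cong) (auto simp: powr_minus_divide)
  also have "\<dots> = real r * t + (real (card B) - real r) / t"
    using assms(2-4) by (simp add: of_nat_diff)
  finally show ?thesis unfolding B .
qed

lemma int_iterate_in_space:
  assumes "invertible_measurable P \<eta>" and "\<omega> \<in> space P"
  shows "int_iterate P \<eta> i \<omega> \<in> space P"
proof -
  have iter: "(h ^^ n) \<omega> \<in> space P" if "h \<in> measurable P P" for h :: "'a \<Rightarrow> 'a" and n
    using assms(2) measurable_space[OF that] by (induction n) auto
  show ?thesis
    using assms(1) iter unfolding int_iterate_def invertible_measurable_def by auto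
qed

theorem theorem6p1:
  fixes M :: "'a measure" and T :: "'a \<Rightarrow> 'a" and \<beta> :: "'a set set" and g :: "'a \<Rightarrow> real"
    and G :: "('a \<Rightarrow> int) set"
    and P :: "'w measure" and \<eta> :: "'w \<Rightarrow> 'w" and \<phi> :: "'w \<Rightarrow> 'a \<Rightarrow> int"
    and r :: nat
  assumes "gibbs_markov M T \<beta> g"
    and "full_branch M T \<beta>"
    and "finite \<beta>"
    and "transition_functions M \<beta> G"
    and "prob_space P"
    and "invertible_measurable P \<eta>"
    and "\<phi> \<in> measurable P (count_space G)"
    and "ergodic_stationary P \<eta>"
    and "1 \<le> r" and "r \<le> card \<beta> - 1"
    and "\<forall>f\<in>G. card {a \<in> \<beta>. value_on f a = 1} = r \<and>
                card {a \<in> \<beta>. value_on f a = - 1} = card \<beta> - r"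
  shows "((INF x\<in>space M. ereal (gibbs_potential g x))
             > ereal (1 / 2 * ln (4 * real r * (real (card \<beta>) - real r))) \<and>
          real r > real (card \<beta>) / 2 \<longrightarrow>
            (\<forall>i. AE \<omega> in P. AE x in M.
               filterlim (\<lambda>n. dwde T P \<eta> \<phi> i n x \<omega>) at_top sequentially))
       \<and> ((INF x\<in>space M. ereal (gibbs_potential g x))
             > ereal (1 / 2 * ln (4 * real r * (real (card \<beta>) - real r))) \<and>
          real r < real (card \<beta>) / 2 \<longrightarrow>
            (\<forall>i. AE \<omega> in P. AE x in M.
               filterlim (\<lambda>n. dwde T P \<eta> \<phi> i n x \<omega>) at_bot sequentially))"
proof -
  let ?k = "real (card \<beta>)"
  let ?c = "1 / 2 * ln (4 * real r * (?k - real r))"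
  \<comment> \<open>This value minimises r t + (k - r) / t over positive t, which makes the
    contraction factor as small as possible.\<close>
  define t where "t = sqrt (?k - real r) / sqrt (real r)"
  have r: "0 < real r" "0 < ?k - real r" "r \<le> card \<beta>"
    using assms(9,10) by linarith+
  have t: "0 < t" unfolding t_def using r by simp
  have M: "markov_map M T \<beta>" "is_derivative_of_measure M T \<beta> g" "prob_space M"
    using assms(1) by (auto simp: gibbs_markov_def)
  have part: "partition_on (space M) \<beta>" and sub: "\<beta> \<subseteq> sets M" and TM: "T \<in> measurable M M"
    using M(1) by (auto simp: markov_map_def nonsingular_def)
  have main: "AE x in M. (\<lambda>n. t powr real_of_int (dwde T P \<eta> \<phi> i n x \<omega>)) \<longlonglongrightarrow> 0"
    if inf: "(INF x\<in>space M. ereal (gibbs_potential g x)) > ereal ?c" and \<omega>: "\<omega> \<in> space P"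
    for i \<omega>
  proof -
    \<comment> \<open>A real number strictly between the two sides: \<open>exp (- d)\<close> bounds
      \<open>g\<close> everywhere, and its product with \<open>exp ?c\<close> is still below
      1.\<close>
    obtain d where d: "?c < d" "ereal d < (INF x\<in>space M. ereal (gibbs_potential g x))"
      using ereal_dense2[OF inf] by auto
    define \<kappa> where "\<kappa> = exp (- d)"
    have \<kappa>: "0 \<le> \<kappa>" by (simp add: \<kappa>_def)
    have g_le: "\<forall>x\<in>space M. g x \<le> \<kappa>"
    proof
      fix x assume x: "x \<in> space M"
      then have "ereal d < ereal (gibbs_potential g x)"
        using d(2) by (meson INF_lower less_le_trans)
      then have "ln (g x) \<le> - d" by (simp add: gibbs_potential_def)
      moreover have "0 < g x" using M(2) x by (auto simp: is_derivative_of_measure_def)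
      ultimately show "g x \<le> \<kappa>"
        unfolding \<kappa>_def by (metis exp_le_cancel_iff exp_ln)
    qed
    let ?f = "environment P \<eta> \<phi> \<omega>"
    define v where "v j a = value_on (?f j) a" for j a
    define \<rho> where "\<rho> = \<kappa> * (real r * t + (?k - real r) / t)"
    have fG: "?f j \<in> G" for j
      using measurable_space[OF assms(7) int_iterate_in_space[OF assms(6) \<omega>]]
      by (simp add: environment_def)
    have const: "?f j x = v j a" if "a \<in> \<beta>" "x \<in> a" for j a x
    proof -
      obtain c where "\<forall>x\<in>a. ?f j x = c"
        using fG[of j] assms(4) \<open>a \<in> \<beta>\<close> unfolding transition_functions_def by blast
      \<comment> \<open>The point \<open>x\<close> shows that \<open>a\<close> is nonempty; the
        image is then a singleton and \<open>the_elem\<close> in \<open>value_on\<close> returns the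
        actual value.\<close>
      then have "?f j ` a = {?f j x}" using \<open>x \<in> a\<close> by auto
      then show ?thesis by (simp add: v_def value_on_def)
    qed
    have sum_v: "\<kappa> * (\<Sum>a\<in>\<beta>. t powr real_of_int (v j a)) \<le> \<rho>" for j
      using assms(11) fG[of j] sum_powr_plus_minus_one[OF assms(3) _ _ r(3) t, of "v j"]
      by (simp add: \<rho>_def v_def)
    have sq: "real r = sqrt (real r) * sqrt (real r)"
      "?k - real r = sqrt (?k - real r) * sqrt (?k - real r)"
      using r by simp_all
    \<comment> \<open>With \<open>A\<close> = sqrt r and \<open>B\<close> = sqrt (k - r),
      \<open>t\<close> is \<open>B / A\<close> and the contributions of the steps +1 and -1 balance:
      each equals \<open>A * B\<close>.\<close>
    have "A * A * (B / A) + B * B / (B / A) = 2 * (A * B)" if "0 < A" "0 < B" for A B :: real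
      using that by simp
    from this[of "sqrt (real r)" "sqrt (?k - real r)"]
    have "real r * t + (?k - real r) / t = 2 * (sqrt (real r) * sqrt (?k - real r))"
      unfolding sq[symmetric] t_def[symmetric] using r by simp
    also have "\<dots> = sqrt (4 * real r * (?k - real r))"
      by (simp add: real_sqrt_mult)
    also have "\<dots> = exp ?c"
    proof -
      have "sqrt y = exp (1 / 2 * ln y)" if "0 < y" for y
        using exp_ln[of "sqrt y"] ln_sqrt[of y] that by simp
      then show ?thesis using r by simp
    qed
    also have "\<dots> < exp d" using d(1) by simp
    finally have "\<rho> < \<kappa> * exp d"
      unfolding \<rho>_def by (intro mult_strict_left_mono) (auto simp: \<kappa>_def)
    then have \<rho>1: "\<rho> < 1" by (simp add: \<kappa>_def exp_minus)
    have \<rho>0: "0 \<le> \<rho>" unfolding \<rho>_def using \<kappa> t r by simp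
    show ?thesis
      unfolding dwde_eq_walk
    proof (rule AE_tendsto_0_of_nn_integral_geometric)
      fix n
      have "?f j \<in> measurable M (count_space UNIV)" for j
        using measurable_count_space_piecewise_constant[OF part sub assms(3), of "?f j" "v j"] const
        by blast
      then have "walk T ?f n i \<in> measurable M (count_space UNIV)"
        by (rule measurable_walk[OF TM])
      then show "(\<lambda>x. t powr real_of_int (walk T ?f n i x)) \<in> borel_measurable M"
        by (rule measurable_compose) simp
      show "(\<integral>\<^sup>+x. ennreal (t powr real_of_int (walk T ?f n i x)) \<partial>M)
           \<le> ennreal (t powr real_of_int i * \<rho> ^ n)"
        using nn_integral_powr_walk_le[OF M(1) assms(2) M(2) assms(3) M(3) g_le \<kappa> const t sum_v] .
    qed (use \<rho>0 \<rho>1 in auto)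
  qed
  show ?thesis
  proof (intro conjI impI allI; elim conjE)
    fix i
    assume inf: "(INF x\<in>space M. ereal (gibbs_potential g x)) > ereal ?c" and "real r > ?k / 2"
    \<comment> \<open>\<open>t\<close> lies below 1 exactly when k - r < r, that is, when upward
      branches are in the majority.\<close>
    then have "t < 1" unfolding t_def using r by simp
    show "AE \<omega> in P. AE x in M. filterlim (\<lambda>n. dwde T P \<eta> \<phi> i n x \<omega>) at_top sequentially"
    proof (rule AE_I2)
      fix \<omega> assume "\<omega> \<in> space P"
      from main[OF inf this]
      show "AE x in M. filterlim (\<lambda>n. dwde T P \<eta> \<phi> i n x \<omega>) at_top sequentially"
        by eventually_elim (rule filterlim_at_top_of_powr_tendsto_0[OF _ t \<open>t < 1\<close>])
    qed
  next
    fix i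
    assume inf: "(INF x\<in>space M. ereal (gibbs_potential g x)) > ereal ?c" and "real r < ?k / 2"
    then have "1 < t" unfolding t_def using r by simp
    show "AE \<omega> in P. AE x in M. filterlim (\<lambda>n. dwde T P \<eta> \<phi> i n x \<omega>) at_bot sequentially"
    proof (rule AE_I2)
      fix \<omega> assume "\<omega> \<in> space P"
      from main[OF inf this]
      show "AE x in M. filterlim (\<lambda>n. dwde T P \<eta> \<phi> i n x \<omega>) at_bot sequentially"
        by eventually_elim (rule filterlim_at_bot_of_powr_tendsto_0[OF _ \<open>1 < t\<close>])
    qed
  qed
qed

end
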